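(* Let $X$ be an approximable and past distinguishing Lorentzian pre-length space satisfying condition (SC) (supremum-compatibility): $$I^-(\sup D)=I^-(D)\quad\text{for every } \preceq_{I^-}\text{-directed } D\subseteq X \text{ admitting a } \preceq_{I^-}\text{-supremum } \sup D .$$ Let $\mathcal C^+(X)$ be the set of indecomposable past sets of $X$ and define $\iota:X\to\mathcal C^+(X)$ by $\iota(x):=I^-(x)$. Then $(\mathcal C^+(X),\subseteq)$ (with the map $\iota$) is the directed completion of $(X,\preceq_{I^-})$. Moreover, $(\mathcal C^+(X),\subseteq)$ is the directed completion of $(X,\leq)$ provided $X$ has closed causal pasts.
   Context: A Lorentzian pre-length space is a quintuple $(X,\mathsf d,\ll,\leq,\ell)$ where $(X,\mathsf d)$ is a separable metric space, $\ll$ is a transitive relation, $\leq$ is a reflexive and transitive relation containing $\ll$, and $\ell:X\times X\to[0,\infty]$ is lower semicontinuous with $\ell(x,y)=0$ if $x\not\leq y$, $\ell(x,y)>0$ iff $x\ll y$, and $\ell(x,z)\geq\ell(x,y)+\ell(y,z)$ for all $x\leq y\leq z$. Put $I^-(x)=\{y:y\ll x\}$, $I^+(x)=\{y:x\ll y\}$, $J^-(x)=\{y:y\leq x\}$, $J^+(x)=\{y:x\leq y\}$, and $I^\pm(A)=\bigcup_{x\in A}I^\pm(x)$ for $A\subseteq X$. $X$ is approximable if $x\in\overline{I^+(x)}\cap\overline{I^-(x)}$ for every $x\in X$; past distinguishing if $I^-(x)=I^-(y)$ implies $x=y$; it has closed causal pasts if $J^-(q)$ is closed in $(X,\mathsf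 d)$ for every $q\in X$. The relation $\preceq_{I^-}$ is defined by $x\preceq_{I^-}y$ iff $I^-(x)\subseteq I^-(y)$ (a partial order when $X$ is past distinguishing). A set $U\subseteq X$ is past if $I^-(U)=U$. A nonempty past set $P$ is an indecomposable past set if whenever $P=U_1\cup U_2$ with past sets $U_1,U_2\subseteq P$, then $P=U_1$ or $P=U_2$. In a poset, $D$ is directed if every finite $F\subseteq D$ (including $F=\emptyset$) has an upper bound in $D$; a poset is directed complete if every directed subset has a supremum. A map $T:(X_1,\leq_1)\to(X_2,\leq_2)$ between posets has the monotone convergence property (Mcp) if for every directed $D\subseteq X_1$ admitting a supremum, $T(D)$ admits a supremum and $\sup T(D)=T(\sup D)$. A directed completion of a poset $(X,\leq)$ is a directed complete poset $(\overline X,\overline\leq)$ with a map $\iota:X\to\overline X$ having the Mcp such that for every directed complete poset $(Z,\leq_Z)$ and every map $T:X\to Z$ with the Mcp there is a unique map $\overline T:\overline X\to Z$ with the Mcp such that $\overline T\circ\iota=T$. *)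

theory Defs
  imports "HOL-Analysis.Analysis"
begin

section \<open>Partially ordered sets with explicit carrier\<close>

text \<open>
  A poset is a carrier \<open>A\<close> with a relation \<open>le\<close> whose values outside \<open>A\<close> are irrelevant.
\<close>

definition poset_on :: "'a set \<Rightarrow> ('a \<Rightarrow> 'a \<Rightarrow> bool) \<Rightarrow> bool" where
  "poset_on A le \<longleftrightarrow> reflp_on A le \<and> antisymp_on A le \<and> transp_on A le"

text \<open>The case \<open>F = {}\<close> forces a directed set to be nonempty.\<close>

definition directed_in :: "'a set \<Rightarrow> ('a \<Rightarrow> 'a \<Rightarrow> bool) \<Rightarrow> 'a set \<Rightarrow> bool" where
  "directed_in A le D \<longleftrightarrow>
     D \<subseteq> A \<and> (\<forall>F. finite F \<and> F \<subseteq> D \<longrightarrow> (\<exists>u\<in>D. \<forall>x\<in>F. le x u))"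

definition is_sup_in :: "'a set \<Rightarrow> ('a \<Rightarrow> 'a \<Rightarrow> bool) \<Rightarrow> 'a set \<Rightarrow> 'a \<Rightarrow> bool" where
  "is_sup_in A le D s \<longleftrightarrow>
     s \<in> A \<and> (\<forall>x\<in>D. le x s) \<and> (\<forall>u\<in>A. (\<forall>x\<in>D. le x u) \<longrightarrow> le s u)"

definition directed_complete_poset :: "'a set \<Rightarrow> ('a \<Rightarrow> 'a \<Rightarrow> bool) \<Rightarrow> bool" where
  "directed_complete_poset A le \<longleftrightarrow>
     poset_on A le \<and> (\<forall>D. directed_in A le D \<longrightarrow> (\<exists>s. is_sup_in A le D s))"

text \<open>
  The monotone convergence property of a map \<open>T : A \<rightarrow> B\<close>: directed suprema that exist
  are mapped to suprema.
\<close>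

definition Mcp ::
  "'a set \<Rightarrow> ('a \<Rightarrow> 'a \<Rightarrow> bool) \<Rightarrow> 'b set \<Rightarrow> ('b \<Rightarrow> 'b \<Rightarrow> bool) \<Rightarrow> ('a \<Rightarrow> 'b) \<Rightarrow> bool" where
  "Mcp A leA B leB T \<longleftrightarrow>
     T \<in> A \<rightarrow> B \<and>
     (\<forall>D s. directed_in A leA D \<and> is_sup_in A leA D s \<longrightarrow> is_sup_in B leB (T ` D) (T s))"

text \<open>
  HOL cannot quantify over types inside a definition, so the type \<open>'z\<close> over which the test
  posets \<open>Z\<close> live is a parameter. The full universal property is the assertion for every
  type \<open>'z\<close>, that is, a theorem in which \<open>'z\<close> is a free type variable. Uniqueness refers to
  maps with domain \<open>Y\<close>, represented by functions that are \<open>undefined\<close> outside \<open>Y\<close>.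
\<close>

definition directed_completion ::
  "'z itself \<Rightarrow> 'a set \<Rightarrow> ('a \<Rightarrow> 'a \<Rightarrow> bool) \<Rightarrow>
    'b set \<Rightarrow> ('b \<Rightarrow> 'b \<Rightarrow> bool) \<Rightarrow> ('a \<Rightarrow> 'b) \<Rightarrow> bool" where
  "directed_completion (_ :: 'z itself) X leX Y leY \<iota> \<longleftrightarrow>
     poset_on X leX \<and>
     directed_complete_poset Y leY \<and>
     Mcp X leX Y leY \<iota> \<and>
     (\<forall>(Z :: 'z set) leZ T.
        directed_complete_poset Z leZ \<and> Mcp X leX Z leZ T \<longrightarrow>
        (\<exists>!T'. T' \<in> Y \<rightarrow>\<^sub>E Z \<and> Mcp Y leY Z leZ T' \<and> (\<forall>x\<in>X. T' (\<iota> x) = T x)))"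

section \<open>Lorentzian pre-length spaces\<close>

definition lower_semicontinuous_map :: "'a topology \<Rightarrow> ('a \<Rightarrow> ennreal) \<Rightarrow> bool" where
  "lower_semicontinuous_map S f \<longleftrightarrow> (\<forall>a. openin S {x \<in> topspace S. a < f x})"

locale lorentzian_pre_length_space = Metric_space X d
  for X :: "'a set" and d :: "'a \<Rightarrow> 'a \<Rightarrow> real" +
  fixes ll :: "'a \<Rightarrow> 'a \<Rightarrow> bool"
    and le :: "'a \<Rightarrow> 'a \<Rightarrow> bool"
    and \<tau> :: "'a \<Rightarrow> 'a \<Rightarrow> ennreal"
  assumes separable: "separable_space mtopology"
    and ll_trans: "transp_on X ll"
    and le_refl: "reflp_on X le"
    and le_trans: "transp_on X le"
    and ll_imp_le: "\<And>x y. \<lbrakk>x \<in> X; y \<in> X; ll x y\<rbrakk> \<Longrightarrow> le x y"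
    and tau_lsc:
      "lower_semicontinuous_map (prod_topology mtopology mtopology) (\<lambda>(x, y). \<tau> x y)"
    and tau_eq_0: "\<And>x y. \<lbrakk>x \<in> X; y \<in> X; \<not> le x y\<rbrakk> \<Longrightarrow> \<tau> x y = 0"
    and tau_pos_iff: "\<And>x y. \<lbrakk>x \<in> X; y \<in> X\<rbrakk> \<Longrightarrow> \<tau> x y > 0 \<longleftrightarrow> ll x y"
    and reverse_triangle:
      "\<And>x y z. \<lbrakk>x \<in> X; y \<in> X; z \<in> X; le x y; le y z\<rbrakk> \<Longrightarrow> \<tau> x z \<ge> \<tau> x y + \<tau> y z"

definition I_past :: "'a set \<Rightarrow> ('a \<Rightarrow> 'a \<Rightarrow> bool) \<Rightarrow> 'a \<Rightarrow> 'a set" where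
  "I_past X ll x = {y \<in> X. ll y x}"

definition I_future :: "'a set \<Rightarrow> ('a \<Rightarrow> 'a \<Rightarrow> bool) \<Rightarrow> 'a \<Rightarrow> 'a set" where
  "I_future X ll x = {y \<in> X. ll x y}"

definition J_past :: "'a set \<Rightarrow> ('a \<Rightarrow> 'a \<Rightarrow> bool) \<Rightarrow> 'a \<Rightarrow> 'a set" where
  "J_past X le x = {y \<in> X. le y x}"

definition I_past_set :: "'a set \<Rightarrow> ('a \<Rightarrow> 'a \<Rightarrow> bool) \<Rightarrow> 'a set \<Rightarrow> 'a set" where
  "I_past_set X ll A = (\<Union>x\<in>A. I_past X ll x)"

definition approximable ::
  "'a set \<Rightarrow> ('a \<Rightarrow> 'a \<Rightarrow> real) \<Rightarrow> ('a \<Rightarrow> 'a \<Rightarrow> bool) \<Rightarrow> bool" where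
  "approximable X d ll \<longleftrightarrow>
     (\<forall>x\<in>X. x \<in> (Metric_space.mtopology X d closure_of I_future X ll x) \<inter>
                 (Metric_space.mtopology X d closure_of I_past X ll x))"

definition past_distinguishing :: "'a set \<Rightarrow> ('a \<Rightarrow> 'a \<Rightarrow> bool) \<Rightarrow> bool" where
  "past_distinguishing X ll \<longleftrightarrow>
     (\<forall>x\<in>X. \<forall>y\<in>X. I_past X ll x = I_past X ll y \<longrightarrow> x = y)"

definition closed_causal_pasts ::
  "'a set \<Rightarrow> ('a \<Rightarrow> 'a \<Rightarrow> real) \<Rightarrow> ('a \<Rightarrow> 'a \<Rightarrow> bool) \<Rightarrow> bool" where
  "closed_causal_pasts X d le \<longleftrightarrow>
     (\<forall>q\<in>X. closedin (Metric_space.mtopology X d) (J_past X le q))"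

definition past_le :: "'a set \<Rightarrow> ('a \<Rightarrow> 'a \<Rightarrow> bool) \<Rightarrow> 'a \<Rightarrow> 'a \<Rightarrow> bool" where
  "past_le X ll x y \<longleftrightarrow> I_past X ll x \<subseteq> I_past X ll y"

definition past_set :: "'a set \<Rightarrow> ('a \<Rightarrow> 'a \<Rightarrow> bool) \<Rightarrow> 'a set \<Rightarrow> bool" where
  "past_set X ll U \<longleftrightarrow> U \<subseteq> X \<and> I_past_set X ll U = U"

definition indecomposable_past_set ::
  "'a set \<Rightarrow> ('a \<Rightarrow> 'a \<Rightarrow> bool) \<Rightarrow> 'a set \<Rightarrow> bool" where
  "indecomposable_past_set X ll P \<longleftrightarrow>
     P \<noteq> {} \<and> past_set X ll P \<and>
     (\<forall>U1 U2. past_set X ll U1 \<and> past_set X ll U2 \<and> U1 \<subseteq> P \<and> U2 \<subseteq> P \<and> P = U1 \<union> U2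
        \<longrightarrow> P = U1 \<or> P = U2)"

definition C_plus :: "'a set \<Rightarrow> ('a \<Rightarrow> 'a \<Rightarrow> bool) \<Rightarrow> 'a set set" where
  "C_plus X ll = {P. indecomposable_past_set X ll P}"

definition sup_compatible :: "'a set \<Rightarrow> ('a \<Rightarrow> 'a \<Rightarrow> bool) \<Rightarrow> bool" where
  "sup_compatible X ll \<longleftrightarrow>
     (\<forall>D s. directed_in X (past_le X ll) D \<and> is_sup_in X (past_le X ll) D s
        \<longrightarrow> I_past X ll s = I_past_set X ll D)"

end

theory Submission
  imports Defs
begin

text \<open>
  In an approximable space the chronological relation is an abstract basis in the sense of
  domain theory: every point has a predecessor, and two predecessors of a point have a common
  successor that still precedes it. This interpolation property is all that the topology
  contributes: chronological futures are open by lower semicontinuity of \<open>\<tau>\<close>, so the future of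
  a predecessor of \<open>x\<close> is a neighbourhood of \<open>x\<close> and meets \<open>I\<^sup>-(x)\<close>, of which \<open>x\<close> is a
  limit point.

  Over an abstract basis the indecomposable past sets are exactly the rounded ideals, that is,
  the nonempty past sets that are directed by the chronological relation
  (\<open>mem_C_plus_iff\<close>). Directed unions of rounded ideals are rounded ideals, so directed suprema
  in \<open>C_plus\<close> are unions. Two facts of density give the universal property. Each \<open>x\<close> is the
  supremum of the directed set \<open>I\<^sup>-(x)\<close> (\<open>is_sup_I_past\<close>), and each rounded ideal \<open>P\<close> is the
  directed union of the sets \<open>I\<^sup>-(x)\<close> with \<open>x \<in> P\<close>. The second fact forces the extension of
  \<open>T\<close> to be \<open>P \<mapsto> sup T(P)\<close>; the first shows that this formula does extend \<open>T\<close>; and it has the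
  monotone convergence property because a supremum over a union is a supremum of suprema.
  Supremum-compatibility says precisely that \<open>\<iota>\<close> turns directed suprema into unions, which
  is its monotone convergence property.

  If causal pasts are closed, then \<open>x \<le> y\<close> and \<open>I\<^sup>-(x) \<subseteq> I\<^sup>-(y)\<close> are equivalent: one direction
  is the push-up property of the time separation, and for the other \<open>x\<close> lies in the closure of
  \<open>I\<^sup>-(x)\<close>, hence in \<open>J\<^sup>-(y)\<close>. So the statement about \<open>\<le>\<close> is the statement about \<open>past_le\<close>.
\<close>

section \<open>Directed sets and suprema\<close>

lemma directed_inI:
  assumes "transp_on A le" "D \<subseteq> A" "D \<noteq> {}"
    and bin: "\<And>x y. \<lbrakk>x \<in> D; y \<in> D\<rbrakk> \<Longrightarrow> \<exists>u\<in>D. le x u \<and> le y u"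
  shows "directed_in A le D"
proof -
  have "\<exists>u\<in>D. \<forall>x\<in>F. le x u" if "finite F" "F \<subseteq> D" for F
    using that
  proof (induction F rule: finite_induct)
    case empty
    then show ?case using \<open>D \<noteq> {}\<close> by auto
  next
    case (insert a F)
    then obtain u where u: "u \<in> D" "\<forall>x\<in>F. le x u" by auto
    obtain v where v: "v \<in> D" "le a v" "le u v"
      using bin[of a u] insert.prems u by auto
    have "le x v" if "x \<in> F" for x
      using transp_onD[OF assms(1), of x u v] that insert.prems u v assms(2) by blast
    then show ?case using v by auto
  qed
  then show ?thesis using assms(2) by (simp add: directed_in_def)
qed

lemma directed_in_nonempty: "directed_in A le D \<Longrightarrow> D \<noteq> {}"
  unfolding directed_in_def by (metis empty_iff empty_subsetI finite.emptyI)

lemma directed_in_pair: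
  assumes "directed_in A le D" "x \<in> D" "y \<in> D"
  shows "\<exists>u\<in>D. le x u \<and> le y u"
proof -
  have "finite {x, y}" "{x, y} \<subseteq> D" using assms by auto
  then have "\<exists>u\<in>D. \<forall>z\<in>{x, y}. le z u"
    using assms(1) unfolding directed_in_def by blast
  then show ?thesis by simp
qed

lemma directed_in_image:
  assumes "directed_in A leA D" "T \<in> A \<rightarrow> B" "transp_on B leB"
    and mono: "\<And>x y. \<lbrakk>x \<in> A; y \<in> A; leA x y\<rbrakk> \<Longrightarrow> leB (T x) (T y)"
  shows "directed_in B leB (T ` D)"
proof (rule directed_inI)
  have "D \<subseteq> A" using assms(1) by (simp add: directed_in_def)
  then show "T ` D \<subseteq> B" using assms(2) by auto
  show "T ` D \<noteq> {}" using directed_in_nonempty[OF assms(1)] by simp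
  show "\<exists>u\<in>T ` D. leB x u \<and> leB y u" if xy: "x \<in> T ` D" "y \<in> T ` D" for x y
  proof -
    obtain a b where ab: "a \<in> D" "b \<in> D" "x = T a" "y = T b" using xy by auto
    obtain c where "c \<in> D" "leA a c" "leA b c"
      using directed_in_pair[OF assms(1) ab(1,2)] by auto
    then show ?thesis using ab mono \<open>D \<subseteq> A\<close> by blast
  qed
qed (rule assms(3))

lemma is_sup_in_unique:
  assumes "antisymp_on A le" "is_sup_in A le D s" "is_sup_in A le D t"
  shows "s = t"
  using assms(2,3) antisymp_onD[OF assms(1)] by (simp add: is_sup_in_def)

text \<open>An element \<open>u\<close> bounds all the \<open>S i\<close> if and only if it bounds all their suprema.\<close>

lemma is_sup_in_UN_iff:
  assumes "transp_on A le"
    and sub: "\<And>i. i \<in> I \<Longrightarrow> S i \<subseteq> A"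
    and sup: "\<And>i. i \<in> I \<Longrightarrow> is_sup_in A le (S i) (s i)"
  shows "is_sup_in A le (\<Union>i\<in>I. S i) t \<longleftrightarrow> is_sup_in A le (s ` I) t"
proof -
  have "(\<forall>x\<in>S i. le x u) \<longleftrightarrow> le (s i) u" if "i \<in> I" "u \<in> A" for i u
  proof
    assume "le (s i) u"
    show "\<forall>x\<in>S i. le x u"
    proof
      fix x assume "x \<in> S i"
      then show "le x u"
        using transp_onD[OF assms(1), of x "s i" u] sub sup that \<open>le (s i) u\<close>
        unfolding is_sup_in_def by blast
    qed
  next
    assume "\<forall>x\<in>S i. le x u"
    then show "le (s i) u" using sup that unfolding is_sup_in_def by blast
  qed
  then have "(\<forall>x\<in>(\<Union>i\<in>I. S i). le x u) \<longleftrightarrow> (\<forall>x\<in>s ` I. le x u)" if "u \<in> A" for u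
    using that by auto
  then show ?thesis unfolding is_sup_in_def by meson
qed

text \<open>If \<open>x\<close> lies below \<open>y\<close>, then \<open>{x, y}\<close> is directed with supremum \<open>y\<close>.\<close>

lemma Mcp_imp_mono:
  assumes "Mcp A leA B leB T" "reflp_on A leA" "x \<in> A" "y \<in> A" "leA x y"
  shows "leB (T x) (T y)"
proof -
  have refl: "leA y y" using assms(2,4) by (simp add: reflp_onD)
  then have "directed_in A leA {x, y}"
    using assms by (auto simp: directed_in_def)
  moreover have "is_sup_in A leA {x, y} y"
    using assms refl by (auto simp: is_sup_in_def)
  ultimately have "is_sup_in B leB (T ` {x, y}) (T y)"
    using assms(1) unfolding Mcp_def by blast
  then show ?thesis by (simp add: is_sup_in_def)
qed

lemma directed_completion_cong:
  fixes Y :: "'b set"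
  assumes eq: "\<And>x y. \<lbrakk>x \<in> X; y \<in> X\<rbrakk> \<Longrightarrow> le x y \<longleftrightarrow> le' x y"
  shows "directed_completion TYPE('z) X le Y leY \<iota> \<longleftrightarrow>
         directed_completion TYPE('z) X le' Y leY \<iota>"
proof -
  have po: "poset_on X le \<longleftrightarrow> poset_on X le'"
    unfolding poset_on_def reflp_on_def antisymp_on_def transp_on_def
    by (simp add: eq cong: ball_cong)
  have dir: "directed_in X le D \<longleftrightarrow> directed_in X le' D" for D
  proof -
    have "(\<forall>x\<in>F. le x u) \<longleftrightarrow> (\<forall>x\<in>F. le' x u)" if "D \<subseteq> X" "F \<subseteq> D" "u \<in> D" for F u
      using that eq by blast
    then show ?thesis unfolding directed_in_def by meson
  qed
  have sup: "is_sup_in X le D s \<longleftrightarrow> is_sup_in X le' D s" if "D \<subseteq> X" for D s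
  proof -
    have "(\<forall>x\<in>D. le x u) \<longleftrightarrow> (\<forall>x\<in>D. le' x u)" if "u \<in> X" for u
      using \<open>D \<subseteq> X\<close> that eq by blast
    then show ?thesis unfolding is_sup_in_def using eq by meson
  qed
  have dirsup: "directed_in X le D \<and> is_sup_in X le D s \<longleftrightarrow>
        directed_in X le' D \<and> is_sup_in X le' D s" for D s
    using dir sup by (auto simp: directed_in_def)
  have "Mcp X le Y leY \<iota> \<longleftrightarrow> Mcp X le' Y leY \<iota>"
    and "Mcp X le Z leZ T \<longleftrightarrow> Mcp X le' Z leZ T" for Z leZ and T :: "'a \<Rightarrow> 'z"
    unfolding Mcp_def by (simp_all add: dirsup)
  then show ?thesis by (simp add: directed_completion_def po)
qed

section \<open>Rounded ideals of an abstract basis\<close>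

text \<open>
  These are the axioms of an abstract basis in domain theory, with interpolation required for
  the empty set and for pairs instead of for arbitrary finite sets.
\<close>

locale abstract_basis =
  fixes X :: "'a set" and ll :: "'a \<Rightarrow> 'a \<Rightarrow> bool"
  assumes transp: "transp_on X ll"
    and predecessor: "x \<in> X \<Longrightarrow> \<exists>y\<in>X. ll y x"
    and interpolation:
      "\<lbrakk>x \<in> X; y \<in> X; z \<in> X; ll x z; ll y z\<rbrakk> \<Longrightarrow> \<exists>w\<in>X. ll x w \<and> ll y w \<and> ll w z"
begin

lemma mem_I_past_set_iff: "y \<in> I_past_set X ll A \<longleftrightarrow> y \<in> X \<and> (\<exists>x\<in>A. ll y x)"
  by (auto simp: I_past_set_def I_past_def)

lemma past_set_I_past_set:
  assumes "A \<subseteq> X"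
  shows "past_set X ll (I_past_set X ll A)"
proof -
  have "y \<in> I_past_set X ll (I_past_set X ll A) \<longleftrightarrow> y \<in> I_past_set X ll A" for y
  proof
    assume "y \<in> I_past_set X ll A"
    then obtain x where "x \<in> A" "y \<in> X" "ll y x" by (auto simp: mem_I_past_set_iff)
    moreover from this obtain z where "z \<in> X" "ll y z" "ll z x"
      using interpolation[of y y x] assms by blast
    ultimately show "y \<in> I_past_set X ll (I_past_set X ll A)"
      unfolding mem_I_past_set_iff Bex_def by blast
  next
    assume "y \<in> I_past_set X ll (I_past_set X ll A)"
    then obtain x z where "x \<in> A" "z \<in> X" "y \<in> X" "ll z x" "ll y z"
      by (auto simp: mem_I_past_set_iff)
    moreover from this have "ll y x" using transp_onD[OF transp, of y z x] assms by blast
    ultimately show "y \<in> I_past_set X ll A" unfolding mem_I_past_set_iff by blast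
  qed
  moreover have "I_past_set X ll A \<subseteq> X" by (auto simp: mem_I_past_set_iff)
  ultimately show ?thesis unfolding past_set_def by blast
qed

lemma past_set_I_past: "x \<in> X \<Longrightarrow> past_set X ll (I_past X ll x)"
  using past_set_I_past_set[of "{x}"] by (simp add: I_past_set_def)

text \<open>
  For \<open>x \<in> P\<close>, the points of \<open>P\<close> in the future of \<open>x\<close> and the remaining points of \<open>P\<close> generate two
  past sets that cover an indecomposable \<open>P\<close>. The second one omits \<open>x\<close>, so the first one is \<open>P\<close>,
  which bounds \<open>x\<close> together with any other point of \<open>P\<close>. Conversely, a common
  upper bound of a point outside \<open>U1\<close> and a point outside \<open>U2\<close> lies in neither past set.
\<close>

lemma mem_C_plus_iff:
  "P \<in> C_plus X ll \<longleftrightarrow>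
     P \<noteq> {} \<and> past_set X ll P \<and> (\<forall>x\<in>P. \<forall>y\<in>P. \<exists>z\<in>P. ll x z \<and> ll y z)"
  (is "_ \<longleftrightarrow> ?ideal")
proof
  assume "P \<in> C_plus X ll"
  then have P: "P \<noteq> {}" "past_set X ll P"
    and indec: "\<And>U1 U2. \<lbrakk>past_set X ll U1; past_set X ll U2; U1 \<subseteq> P; U2 \<subseteq> P; P = U1 \<union> U2\<rbrakk>
        \<Longrightarrow> P = U1 \<or> P = U2"
    unfolding C_plus_def indecomposable_past_set_def by blast+
  have PX: "P \<subseteq> X" and past: "I_past_set X ll P = P"
    using P by (auto simp: past_set_def)
  have "\<exists>z\<in>P. ll x z \<and> ll y z" if x: "x \<in> P" and y: "y \<in> P" for x y
  proof -
    define F where "F = {w \<in> P. ll x w}"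
    define U1 where "U1 = I_past_set X ll F"
    define U2 where "U2 = I_past_set X ll (P - F)"
    have "U1 \<union> U2 = I_past_set X ll P"
      unfolding U1_def U2_def F_def I_past_set_def by blast
    then have cover: "P = U1 \<union> U2" using past by simp
    have "past_set X ll U1" "past_set X ll U2"
      unfolding U1_def U2_def F_def
      by (rule past_set_I_past_set, use PX in blast)+
    then have "P = U1 \<or> P = U2" using indec[of U1 U2] cover by blast
    moreover have "P \<noteq> U2"
    proof
      assume "P = U2"
      then have "x \<in> U2" using x by blast
      then show False by (auto simp: U2_def F_def mem_I_past_set_iff)
    qed
    ultimately have "y \<in> U1" using y by blast
    then show ?thesis by (auto simp: U1_def F_def mem_I_past_set_iff)
  qed
  then show ?ideal using P by blast
next
  assume ideal: ?ideal
  have "P = U1 \<or> P = U2"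
    if U: "past_set X ll U1" "past_set X ll U2" "P = U1 \<union> U2" for U1 U2
  proof (rule ccontr)
    assume "\<not> (P = U1 \<or> P = U2)"
    then obtain x y where xy: "x \<in> P" "x \<notin> U1" "y \<in> P" "y \<notin> U2"
      using U(3) by blast
    then obtain z where z: "z \<in> P" "ll x z" "ll y z" using ideal by blast
    have "x \<in> X" "y \<in> X" using xy ideal unfolding past_set_def by blast+
    moreover have "I_past_set X ll U1 = U1" "I_past_set X ll U2 = U2"
      using U(1,2) by (simp_all add: past_set_def)
    ultimately have "z \<notin> U1" "z \<notin> U2"
      using xy z mem_I_past_set_iff by metis+
    then show False using z U(3) by blast
  qed
  then show "P \<in> C_plus X ll"
    using ideal by (auto simp: C_plus_def indecomposable_past_set_def)
qed

lemma C_plus_subset: "P \<in> C_plus X ll \<Longrightarrow> P \<subseteq> X"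
  by (simp add: mem_C_plus_iff past_set_def)

lemma C_plus_directed:
  "\<lbrakk>P \<in> C_plus X ll; x \<in> P; y \<in> P\<rbrakk> \<Longrightarrow> \<exists>z\<in>P. ll x z \<and> ll y z"
  by (simp add: mem_C_plus_iff)

lemma UN_I_past_eq: "P \<in> C_plus X ll \<Longrightarrow> \<Union> (I_past X ll ` P) = P"
  by (simp add: mem_C_plus_iff past_set_def I_past_set_def)

lemma I_past_in_C_plus:
  assumes "x \<in> X"
  shows "I_past X ll x \<in> C_plus X ll"
proof -
  have "I_past X ll x \<noteq> {}" using predecessor[OF assms] by (auto simp: I_past_def)
  moreover have "\<exists>w\<in>I_past X ll x. ll y w \<and> ll z w"
    if "y \<in> I_past X ll x" "z \<in> I_past X ll x" for y z
    using interpolation[of y z x] that assms by (auto simp: I_past_def)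
  ultimately show ?thesis
    unfolding mem_C_plus_iff using past_set_I_past[OF assms] by blast
qed

lemma Union_directed_in_C_plus:
  assumes dir: "directed_in (C_plus X ll) (\<subseteq>) \<D>"
  shows "\<Union>\<D> \<in> C_plus X ll"
  unfolding mem_C_plus_iff
proof (intro conjI ballI)
  have sub: "\<And>P. P \<in> \<D> \<Longrightarrow> P \<in> C_plus X ll" using dir by (auto simp: directed_in_def)
  obtain P where "P \<in> \<D>" using directed_in_nonempty[OF dir] by blast
  moreover from this have "P \<noteq> {}" using sub[of P] by (simp add: mem_C_plus_iff)
  ultimately show "\<Union>\<D> \<noteq> {}" by blast
  have "I_past_set X ll (\<Union>\<D>) = (\<Union>P\<in>\<D>. I_past_set X ll P)"
    by (auto simp: I_past_set_def)
  also have "\<dots> = \<Union>\<D>" using sub by (force simp: mem_C_plus_iff past_set_def)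
  finally show "past_set X ll (\<Union>\<D>)"
    using sub C_plus_subset unfolding past_set_def by blast
  fix x y assume "x \<in> \<Union>\<D>" "y \<in> \<Union>\<D>"
  then obtain P Q where "P \<in> \<D>" "Q \<in> \<D>" "x \<in> P" "y \<in> Q" by blast
  moreover from this obtain R where "R \<in> \<D>" "P \<subseteq> R" "Q \<subseteq> R"
    using directed_in_pair[OF dir] by meson
  ultimately show "\<exists>z\<in>\<Union>\<D>. ll x z \<and> ll y z"
    using C_plus_directed[OF sub, of R x y] by blast
qed

lemma is_sup_C_plus_iff:
  assumes "\<Union>\<D> \<in> C_plus X ll"
  shows "is_sup_in (C_plus X ll) (\<subseteq>) \<D> S \<longleftrightarrow> S = \<Union>\<D>"
proof
  assume "is_sup_in (C_plus X ll) (\<subseteq>) \<D> S"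
  then have "\<Union>\<D> \<subseteq> S" "S \<subseteq> \<Union>\<D>"
    using assms unfolding is_sup_in_def by (blast, meson Union_upper)
  then show "S = \<Union>\<D>" by simp
next
  assume "S = \<Union>\<D>"
  then show "is_sup_in (C_plus X ll) (\<subseteq>) \<D> S"
    using assms unfolding is_sup_in_def by blast
qed

lemma poset_on_subset: "poset_on A (\<subseteq>)"
  by (auto simp: poset_on_def reflp_on_def antisymp_on_def transp_on_def)

lemma directed_complete_C_plus: "directed_complete_poset (C_plus X ll) (\<subseteq>)"
  unfolding directed_complete_poset_def
  using poset_on_subset is_sup_C_plus_iff[OF Union_directed_in_C_plus] by blast

lemma poset_on_past_le: "past_distinguishing X ll \<Longrightarrow> poset_on X (past_le X ll)"
  by (auto simp: poset_on_def past_le_def reflp_on_def antisymp_on_def transp_on_def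
      past_distinguishing_def)

lemma ll_imp_past_le: "\<lbrakk>x \<in> X; y \<in> X; ll x y\<rbrakk> \<Longrightarrow> past_le X ll x y"
  by (auto simp: past_le_def I_past_def intro: transp_onD[OF transp, of _ x y])

lemma directed_in_C_plus_member:
  assumes "P \<in> C_plus X ll"
  shows "directed_in X (past_le X ll) P"
proof (rule directed_inI)
  show PX: "P \<subseteq> X" by (rule C_plus_subset[OF assms])
  show "transp_on X (past_le X ll)" by (auto simp: transp_on_def past_le_def)
  show "P \<noteq> {}" using assms by (simp add: mem_C_plus_iff)
  show "\<exists>u\<in>P. past_le X ll x u \<and> past_le X ll y u" if xy: "x \<in> P" "y \<in> P" for x y
  proof -
    obtain z where z: "z \<in> P" "ll x z" "ll y z" using C_plus_directed[OF assms xy] by blast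
    then have "past_le X ll x z" "past_le X ll y z"
      using xy PX by (simp_all add: ll_imp_past_le subset_iff)
    then show ?thesis using z(1) by blast
  qed
qed

text \<open>
  An upper bound \<open>u\<close> of \<open>I\<^sup>-(x)\<close> satisfies \<open>I\<^sup>-(I\<^sup>-(x)) \<subseteq> I\<^sup>-(u)\<close>, and the left-hand side is
  \<open>I\<^sup>-(x)\<close> by interpolation.
\<close>

lemma is_sup_I_past:
  assumes "x \<in> X"
  shows "is_sup_in X (past_le X ll) (I_past X ll x) x"
  unfolding is_sup_in_def
proof (intro conjI ballI impI)
  show "past_le X ll y x" if "y \<in> I_past X ll x" for y
    using that ll_imp_past_le assms by (simp add: I_past_def)
  fix u assume "\<forall>y\<in>I_past X ll x. past_le X ll y u"
  then have "\<Union> (I_past X ll ` I_past X ll x) \<subseteq> I_past X ll u"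
    by (simp add: past_le_def UN_subset_iff)
  then show "past_le X ll x u"
    unfolding past_le_def UN_I_past_eq[OF I_past_in_C_plus[OF assms]] .
qed (rule assms)

section \<open>The universal property of the rounded ideal completion\<close>

lemma Mcp_I_past:
  assumes "sup_compatible X ll"
  shows "Mcp X (past_le X ll) (C_plus X ll) (\<subseteq>) (I_past X ll)"
  unfolding Mcp_def
proof (intro conjI allI impI)
  show "I_past X ll \<in> X \<rightarrow> C_plus X ll" by (simp add: I_past_in_C_plus)
  fix D s assume Ds: "directed_in X (past_le X ll) D \<and> is_sup_in X (past_le X ll) D s"
  then have "I_past X ll s = I_past_set X ll D"
    using assms unfolding sup_compatible_def by blast
  then have eq: "\<Union> (I_past X ll ` D) = I_past X ll s" by (simp add: I_past_set_def)
  have "s \<in> X" using Ds by (simp add: is_sup_in_def)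
  then have "\<Union> (I_past X ll ` D) \<in> C_plus X ll" by (simp add: eq I_past_in_C_plus)
  then show "is_sup_in (C_plus X ll) (\<subseteq>) (I_past X ll ` D) (I_past X ll s)"
    by (simp add: is_sup_C_plus_iff eq)
qed

text \<open>
  Existence: an indecomposable past set is directed in \<open>X\<close>, so its image under the monotone map
  \<open>T\<close> has a supremum in \<open>Z\<close>. Uniqueness: any extension sends the directed family of all
  \<open>I\<^sup>-(x)\<close> with \<open>x \<in> P\<close> to \<open>T(P)\<close> and preserves its supremum, which is \<open>P\<close>.
\<close>

lemma ex1_Mcp_extension:
  assumes Z: "directed_complete_poset Z leZ"
    and T: "Mcp X (past_le X ll) Z leZ T"
  shows "\<exists>!T'. T' \<in> C_plus X ll \<rightarrow>\<^sub>E Z \<and> Mcp (C_plus X ll) (\<subseteq>) Z leZ T' \<and>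
           (\<forall>x\<in>X. T' (I_past X ll x) = T x)"
proof -
  let ?C = "C_plus X ll"
  have TZ: "T \<in> X \<rightarrow> Z" using T by (simp add: Mcp_def)
  have trans: "transp_on Z leZ" and anti: "antisymp_on Z leZ"
    using Z by (auto simp: directed_complete_poset_def poset_on_def)
  have refl: "reflp_on X (past_le X ll)" by (auto simp: reflp_on_def past_le_def)
  have TP: "T ` P \<subseteq> Z" if "P \<in> ?C" for P using TZ C_plus_subset[OF that] by auto
  define E where "E = (\<lambda>P\<in>?C. SOME s. is_sup_in Z leZ (T ` P) s)"
  have E: "is_sup_in Z leZ (T ` P) (E P)" if "P \<in> ?C" for P
  proof -
    have "directed_in Z leZ (T ` P)"
      by (rule directed_in_image[OF directed_in_C_plus_member[OF that] TZ trans])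
        (rule Mcp_imp_mono[OF T refl])
    then have "\<exists>s. is_sup_in Z leZ (T ` P) s"
      using Z by (simp add: directed_complete_poset_def)
    then show ?thesis using that by (simp add: E_def someI_ex)
  qed
  show ?thesis
  proof (rule ex1I[of _ E], intro conjI ballI)
    show EZ: "E \<in> ?C \<rightarrow>\<^sub>E Z" using E by (auto simp: is_sup_in_def E_def)
    show "E (I_past X ll x) = T x" if "x \<in> X" for x
    proof (rule is_sup_in_unique[OF anti E])
      show I: "I_past X ll x \<in> ?C" by (rule I_past_in_C_plus[OF that])
      show "is_sup_in Z leZ (T ` I_past X ll x) (T x)"
        using T is_sup_I_past[OF that] directed_in_C_plus_member[OF I] unfolding Mcp_def by blast
    qed
    show "Mcp ?C (\<subseteq>) Z leZ E"
      unfolding Mcp_def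
    proof (intro conjI allI impI)
      show "E \<in> ?C \<rightarrow> Z" using EZ by (simp add: PiE_def)
      fix \<D> S assume \<D>: "directed_in ?C (\<subseteq>) \<D> \<and> is_sup_in ?C (\<subseteq>) \<D> S"
      then have sub: "\<And>P. P \<in> \<D> \<Longrightarrow> P \<in> ?C" by (auto simp: directed_in_def)
      have "\<Union>\<D> \<in> ?C" using \<D> Union_directed_in_C_plus by simp
      then have S: "S = \<Union>\<D>" "S \<in> ?C" using \<D> by (simp_all add: is_sup_C_plus_iff)
      have "is_sup_in Z leZ (\<Union>P\<in>\<D>. T ` P) (E S)"
        using E[OF S(2)] S(1) by (simp add: image_Union)
      then show "is_sup_in Z leZ (E ` \<D>) (E S)"
        using is_sup_in_UN_iff[OF trans, of \<D> "(`) T" E] TP[OF sub] E[OF sub] by simp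
    qed
  next
    fix T' assume T': "T' \<in> ?C \<rightarrow>\<^sub>E Z \<and> Mcp ?C (\<subseteq>) Z leZ T' \<and>
      (\<forall>x\<in>X. T' (I_past X ll x) = T x)"
    have "T' P = E P" if P: "P \<in> ?C" for P
    proof (rule is_sup_in_unique[OF anti _ E[OF P]])
      have "directed_in ?C (\<subseteq>) (I_past X ll ` P)"
        by (rule directed_in_image[OF directed_in_C_plus_member[OF P]])
          (use I_past_in_C_plus in \<open>auto simp: past_le_def transp_on_def\<close>)
      moreover have "is_sup_in ?C (\<subseteq>) (I_past X ll ` P) P"
        using is_sup_C_plus_iff[of "I_past X ll ` P" P] UN_I_past_eq[OF P] P by simp
      ultimately have "is_sup_in Z leZ (T' ` I_past X ll ` P) (T' P)"
        using T' unfolding Mcp_def by blast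
      moreover have "T' ` I_past X ll ` P = T ` P"
        using T' C_plus_subset[OF P] by (force simp: image_image)
      ultimately show "is_sup_in Z leZ (T ` P) (T' P)" by simp
    qed
    then show "T' = E" using T' by (intro extensionalityI[of _ ?C]) (auto simp: E_def PiE_def)
  qed
qed

theorem directed_completion_C_plus:
  assumes "past_distinguishing X ll" "sup_compatible X ll"
  shows "directed_completion TYPE('z) X (past_le X ll) (C_plus X ll) (\<subseteq>) (I_past X ll)"
  by (simp add: directed_completion_def poset_on_past_le[OF assms(1)] directed_complete_C_plus
      Mcp_I_past[OF assms(2)] ex1_Mcp_extension)

end

section \<open>Lorentzian pre-length spaces\<close>

context lorentzian_pre_length_space
begin

lemma ll_le_trans:
  assumes "x \<in> X" "y \<in> X" "z \<in> X" "ll x y" "le y z"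
  shows "ll x z"
proof -
  have "0 < \<tau> x y" using tau_pos_iff assms by blast
  also have "\<dots> \<le> \<tau> x y + \<tau> y z" by simp
  also have "\<dots> \<le> \<tau> x z" using reverse_triangle ll_imp_le assms by blast
  finally show ?thesis using tau_pos_iff assms by blast
qed

text \<open>
  The future of \<open>x\<close> is the slice at \<open>x\<close> of the set where \<open>\<tau>\<close> is positive, which is open by
  lower semicontinuity.
\<close>

lemma openin_I_future:
  assumes "x \<in> X"
  shows "openin mtopology (I_future X ll x)"
proof -
  let ?W = "{p \<in> X \<times> X. 0 < (\<lambda>(x, y). \<tau> x y) p}"
  have "openin (prod_topology mtopology mtopology) ?W"
    using tau_lsc unfolding lower_semicontinuous_map_def by (metis topspace_mtopology topspace_prod_topology)
  moreover have "continuous_map mtopology (prod_topology mtopology mtopology) (\<lambda>y. (x, y))"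
    using assms by (simp add: continuous_map_pairwise o_def)
  ultimately have "openin mtopology {y \<in> topspace mtopology. (x, y) \<in> ?W}"
    by (rule openin_continuous_map_preimage[rotated])
  moreover have "{y \<in> topspace mtopology. (x, y) \<in> ?W} = I_future X ll x"
    using assms tau_pos_iff by (auto simp: I_future_def)
  ultimately show ?thesis by simp
qed

text \<open>
  Futures are open, and every neighbourhood of \<open>z\<close> meets \<open>I\<^sup>-(z)\<close>: the whole space gives a
  predecessor of \<open>z\<close>, and the intersection of two futures that contain \<open>z\<close> gives interpolation.
\<close>

lemma abstract_basis_if_approximable:
  assumes "approximable X d ll"
  shows "abstract_basis X ll"
proof
  have closure: "x \<in> mtopology closure_of I_past X ll x" if "x \<in> X" for x
    using assms that by (simp add: approximable_def)
  have meets: "\<exists>w\<in>U. w \<in> X \<and> ll w x" if "openin mtopology U" "x \<in> U" for U x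
  proof -
    have "x \<in> X" using openin_subset that by fastforce
    then show ?thesis
      using closure[of x] that unfolding in_closure_of I_past_def by blast
  qed
  show "transp_on X ll" by (rule ll_trans)
  show "\<exists>y\<in>X. ll y x" if "x \<in> X" for x
    using meets[of X x] that openin_topspace[of mtopology] by auto
  show "\<exists>w\<in>X. ll x w \<and> ll y w \<and> ll w z"
    if "x \<in> X" "y \<in> X" "z \<in> X" "ll x z" "ll y z" for x y z
    using meets[of "I_future X ll x \<inter> I_future X ll y" z] that openin_I_future
    by (auto simp: I_future_def)
qed

lemma le_iff_past_le:
  assumes "approximable X d ll" "closed_causal_pasts X d le" "x \<in> X" "y \<in> X"
  shows "le x y \<longleftrightarrow> past_le X ll x y"
proof
  assume "le x y"
  then show "past_le X ll x y"
    using ll_le_trans assms(3,4) by (auto simp: past_le_def I_past_def)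
next
  assume "past_le X ll x y"
  then have "I_past X ll x \<subseteq> J_past X le y"
    using ll_imp_le assms(4) by (auto simp: past_le_def I_past_def J_past_def)
  moreover have "closedin mtopology (J_past X le y)"
    using assms(2,4) by (simp add: closed_causal_pasts_def)
  ultimately have "mtopology closure_of I_past X ll x \<subseteq> J_past X le y"
    by (rule closure_of_minimal)
  then show "le x y" using assms(1,3) by (auto simp: approximable_def J_past_def)
qed

end

theorem theorem3p15:
  fixes X :: "'a set"
    and d :: "'a \<Rightarrow> 'a \<Rightarrow> real"
    and ll le :: "'a \<Rightarrow> 'a \<Rightarrow> bool"
    and \<tau> :: "'a \<Rightarrow> 'a \<Rightarrow> ennreal"
  assumes "lorentzian_pre_length_space X d ll le \<tau>"
    and "approximable X d ll"
    and "past_distinguishing X ll"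
    and "sup_compatible X ll"
  shows "directed_completion TYPE('z) X (past_le X ll) (C_plus X ll) (\<subseteq>) (I_past X ll) \<and>
         (closed_causal_pasts X d le \<longrightarrow>
           directed_completion TYPE('z) X le (C_plus X ll) (\<subseteq>) (I_past X ll))"
proof -
  interpret lorentzian_pre_length_space X d ll le \<tau> by (rule assms(1))
  interpret abstract_basis X ll by (rule abstract_basis_if_approximable[OF assms(2)])
  have past_le: "directed_completion TYPE('z) X (past_le X ll) (C_plus X ll) (\<subseteq>) (I_past X ll)"
    by (rule directed_completion_C_plus[OF assms(3,4)])
  moreover have "directed_completion TYPE('z) X le (C_plus X ll) (\<subseteq>) (I_past X ll)"
    if closed: "closed_causal_pasts X d le"
  proof (rule iffD2[OF directed_completion_cong past_le])
    show "le x y \<longleftrightarrow> past_le X ll x y" if "x \<in> X" "y \<in> X" for x y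
      by (rule le_iff_past_le[OF assms(2) closed that])
  qed
  ultimately show ?thesis by blast
qed

end
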